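(* There is a constant $c>1/2$ such that for every prime $p$ there exists $n_0=n_0(p)$ such that for every integer $n\ge n_0$ there exists a subset $A\subseteq \mathbb{F}_p^n$ of size $|A|\ge (cp)^n$ not containing a three-term arithmetic progression. (The constant $c$ is absolute, i.e. independent of $p$ and $n$.)
   Context: A three-term arithmetic progression in $\mathbb{F}_p^n$ consists of three distinct elements $x,y,z\in \mathbb{F}_p^n$ with $x-2y+z=0$. A subset $A$ does not contain a three-term arithmetic progression if there are no three (pairwise) distinct elements $x,y,z\in A$ with $x-2y+z=0$. *)

theory Defs
  imports Complex_Main "HOL-Library.FuncSet" "HOL-Number_Theory.Residues"
begin

(* residue_ring p is F_p on the representatives 0, ..., p - 1, and a vector is an extensional
   function on {0, ..., n - 1}: equality of vectors in Fp_space p n is therefore equality of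
   functions, and cardinalities in F_p^n are plain set cardinalities. *)
definition Fp_space :: "nat \<Rightarrow> nat \<Rightarrow> (nat \<Rightarrow> int) set" where
  "Fp_space p n = {..<n} \<rightarrow>\<^sub>E carrier (residue_ring (int p))"

(* The congruence says that x - 2y + z = 0 holds in F_p, coordinate by coordinate. *)
definition three_term_AP ::
    "nat \<Rightarrow> nat \<Rightarrow> (nat \<Rightarrow> int) \<Rightarrow> (nat \<Rightarrow> int) \<Rightarrow> (nat \<Rightarrow> int) \<Rightarrow> bool" where
  "three_term_AP p n x y z \<longleftrightarrow>
     x \<in> Fp_space p n \<and> y \<in> Fp_space p n \<and> z \<in> Fp_space p n \<and>
     x \<noteq> y \<and> y \<noteq> z \<and> x \<noteq> z \<and>
     (\<forall>i<n. [x i - 2 * y i + z i = 0] (mod int p))"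

definition three_AP_free :: "nat \<Rightarrow> nat \<Rightarrow> (nat \<Rightarrow> int) set \<Rightarrow> bool" where
  "three_AP_free p n A \<longleftrightarrow> \<not> (\<exists>x\<in>A. \<exists>y\<in>A. \<exists>z\<in>A. three_term_AP p n x y z)"

end

theory Submission
  imports Defs "HOL-Real_Asymp.Real_Asymp"
begin

text \<open>
  For odd \<open>p = 2 * h + 1\<close> it suffices to find a set \<open>S\<close> of at least \<open>9 / 32 * p\<^sup>2\<close> points in the plane
  over \<open>F\<^sub>p\<close> and a bounded weight on \<open>S\<close> such that the middle term of every nontrivial progression
  in \<open>S\<close> weighs less than the average of the outer terms: a level set of the total weight on a power of
  \<open>S\<close> is then free of progressions, and by pigeonhole some level set loses only a polynomial factor.

  Let the weight be \<open>a\<^sup>2\<close>, with ties broken inside the fibre over \<open>a\<close>, where \<open>a\<close> runs through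
  \<open>0, \<dots>, 3p/4\<close>. Convexity handles all progressions of first coordinates except those with
  \<open>ax + az = 2 * a - p\<close>. They are excluded through the second coordinate: the fibres over small \<open>a\<close> are
  shortened to \<open>{0..<p/4 + a}\<close>, and the fibre over a large \<open>a\<close> consists of the \<open>b\<close> for which \<open>2 * b\<close>
  is outside the sumsets of the fibres over \<open>ax\<close> and \<open>az\<close>. The shortening costs \<open>p\<^sup>2 / 32\<close> points
  of the half square \<open>{0..h} \<times> {0..h}\<close>, the new fibres contribute \<open>p\<^sup>2 / 16\<close>.
\<close>

section \<open>The planar digit set and its weight\<close>

definition digit_fibre :: "int \<Rightarrow> int \<Rightarrow> int set" where
  "digit_fibre h a =
     (let p = 2 * h + 1; d = (h + 1) div 2
      in if a \<le> h then {0..<min (h + 1) (d + a)}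
         else {b \<in> {0..<p}. 2 * d + 2 * (a - h - 1) \<le> (2 * b) mod p})"

definition digit_pairs :: "int \<Rightarrow> (int \<times> int) set" where
  "digit_pairs h = Sigma {0..<h + 1 + (h + 1) div 2} (digit_fibre h)"

text \<open>Doubling carries the fibres over large \<open>a\<close> into an interval of length at most \<open>h + 1\<close>, in which
  progressions modulo \<open>2 * h + 1\<close> do not wrap around.\<close>
definition fibre_coord :: "int \<Rightarrow> int \<times> int \<Rightarrow> int" where
  "fibre_coord h v = (if fst v \<le> h then snd v else (2 * snd v) mod (2 * h + 1))"

text \<open>The order is lexicographic: \<open>fibre_coord\<close> stays below
  \<open>2 * h + 1\<close>, so a strict gain in the squares of the first coordinates outweighs any
  loss in the second summand.\<close>

definition weight :: "int \<Rightarrow> int \<times> int \<Rightarrow> int" where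
  "weight h v = 2 * (2 * h + 1)\<^sup>2 * (fst v)\<^sup>2 + (fibre_coord h v)\<^sup>2"

section \<open>Integer inequalities, small multiples of the modulus, ranges\<close>

lemma square_AP_strict:
  fixes x y z :: int
  assumes "x + z = 2 * y"
  shows "x = y \<and> y = z \<or> 2 * y\<^sup>2 < x\<^sup>2 + z\<^sup>2"
proof -
  have z: "z = 2 * y - x" using assms by simp
  have "x\<^sup>2 + z\<^sup>2 = 2 * y\<^sup>2 + 2 * (x - y)\<^sup>2"
    unfolding z by (simp add: power2_eq_square algebra_simps)
  moreover have "x \<noteq> y \<Longrightarrow> (x - y)\<^sup>2 > 0" by simp
  ultimately show ?thesis using z by (cases "x = y") auto
qed

lemma square_less_of_range:
  fixes x m :: int
  assumes "0 \<le> x" "x < m"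
  shows "x\<^sup>2 < m\<^sup>2"
  using assms by (simp add: power_strict_mono)

text \<open>Second differences x - 2y + z of reduced residues lie in this range: either there is no
  wrap-around, or one wrap in either direction.\<close>

lemma dvd_small_cases:
  fixes p t :: int
  assumes "p dvd t" "- (2 * p) < t" "t < 2 * p"
  shows "t = - p \<or> t = 0 \<or> t = p"
proof -
  obtain k where k: "t = p * k" using assms(1) by blast
  have p: "p > 0" using assms by linarith
  have "p * k < p * 2" "p * (-2) < p * k" using assms k by (auto simp: mult.commute)
  hence "k < 2" "-2 < k" using p mult_less_cancel_left_pos by blast+
  hence "k = -1 \<or> k = 0 \<or> k = 1" by linarith
  thus ?thesis using k by auto
qed

lemma dvd_range_zero:
  fixes p t :: int
  assumes "p dvd t" "- p < t" "t < p"
  shows "t = 0"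
  using dvd_small_cases[of p t] assms by linarith

lemma mod_odd_le: "h \<ge> 1 \<Longrightarrow> x mod (2 * h + 1) \<le> 2 * h" for h x :: int
  using pos_mod_bound[of "2 * h + 1" x] by linarith

lemma finite_digit_fibre: "finite (digit_fibre h a)"
  by (rule finite_subset[of _ "{0..<h + 1} \<union> {0..<2 * h + 1}"])
    (auto simp: digit_fibre_def Let_def split: if_splits)

lemma finite_digit_pairs: "finite (digit_pairs h)"
  by (simp add: digit_pairs_def finite_digit_fibre)

lemma fibre_coord_bounds:
  assumes "v \<in> digit_pairs h" "h \<ge> 1"
  shows "0 \<le> fibre_coord h v" "fibre_coord h v < 2 * h + 1"
  using assms by (auto simp: digit_pairs_def digit_fibre_def fibre_coord_def Let_def mod_odd_le)

lemma digit_pairs_range: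
  assumes "(a, b) \<in> digit_pairs h" "h \<ge> 1"
  shows "0 \<le> a" "a < 2 * h + 1" "0 \<le> b" "b < 2 * h + 1"
  using assms by (auto simp: digit_pairs_def digit_fibre_def Let_def split: if_splits)

text \<open>The bound depends on \<open>h\<close> alone, so the total weight of m digits takes only
  O(m) values.\<close>

lemma weight_bounds:
  assumes "v \<in> digit_pairs h" "h \<ge> 1"
  shows "0 \<le> weight h v" "weight h v < 3 * (2 * h + 1) ^ 4"
proof -
  obtain a b where v: "v = (a, b)" by (cases v)
  let ?p = "2 * h + 1"
  have "a\<^sup>2 < ?p\<^sup>2"
    using square_less_of_range digit_pairs_range[of a b h] assms v by auto
  hence "2 * ?p\<^sup>2 * a\<^sup>2 \<le> 2 * ?p\<^sup>2 * ?p\<^sup>2" by (intro mult_left_mono) auto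
  moreover have "(fibre_coord h v)\<^sup>2 < ?p\<^sup>2"
    using square_less_of_range fibre_coord_bounds[OF assms] by auto
  moreover have "?p\<^sup>2 * 1 \<le> ?p\<^sup>2 * ?p\<^sup>2"
    using assms(2) by (intro mult_left_mono) auto
  moreover have "?p ^ 4 = ?p\<^sup>2 * ?p\<^sup>2" by (simp flip: power_add)
  ultimately show "weight h v < 3 * ?p ^ 4" unfolding weight_def v fst_conv by linarith
  show "0 \<le> weight h v" by (simp add: weight_def)
qed

section \<open>Progressions modulo 2h + 1 in the digit set\<close>

lemma fibre_AP_strict:
  assumes h: "h \<ge> 1"
    and x: "(a, bx) \<in> digit_pairs h" and y: "(a, b) \<in> digit_pairs h" and z: "(a, bz) \<in> digit_pairs h"
    and AP: "2 * h + 1 dvd bx - 2 * b + bz"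
  shows "bx = b \<and> b = bz \<or>
    2 * (fibre_coord h (a, b))\<^sup>2 < (fibre_coord h (a, bx))\<^sup>2 + (fibre_coord h (a, bz))\<^sup>2"
proof (cases "a \<le> h")
  case True
  hence "0 \<le> bx" "bx \<le> h" "0 \<le> b" "b \<le> h" "0 \<le> bz" "bz \<le> h"
    using x y z by (auto simp: digit_pairs_def digit_fibre_def Let_def)
  with AP have "bx - 2 * b + bz = 0" by (intro dvd_range_zero[of "2 * h + 1"]) auto
  with square_AP_strict[of bx bz b] show ?thesis using True by (simp add: fibre_coord_def)
next
  case False
  let ?p = "2 * h + 1" and ?w = "\<lambda>b. (2 * b) mod (2 * h + 1)"
  \<comment> \<open>The doubled residues fill at most the interval from h to 2h, so their second
    differences are at most 2h in absolute value.\<close>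
  have w: "h \<le> ?w c" "?w c < ?p" if "(a, c) \<in> digit_pairs h" for c
  proof -
    have "2 * ((h + 1) div 2) + 2 * (a - h - 1) \<le> ?w c"
      using that False by (simp add: digit_pairs_def digit_fibre_def Let_def)
    moreover have "h \<le> 2 * ((h + 1) div 2) + 2 * (a - h - 1)" using False by presburger
    ultimately show "h \<le> ?w c" by (rule order_trans[rotated])
    show "?w c < ?p" using h by (intro pos_mod_bound) simp
  qed
  have mod_dvd: "?p dvd ?w c - 2 * c" for c
    by (simp flip: mod_eq_dvd_iff)
  have "?p dvd 2 * (bx - 2 * b + bz) + (?w bx - 2 * bx) - 2 * (?w b - 2 * b) + (?w bz - 2 * bz)"
    by (rule dvd_add[OF dvd_diff[OF dvd_add[OF dvd_mult[OF AP] mod_dvd] dvd_mult[OF mod_dvd]] mod_dvd])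
  hence "?p dvd ?w bx - 2 * ?w b + ?w bz" by (simp add: algebra_simps)
  hence 0: "?w bx - 2 * ?w b + ?w bz = 0"
    using w[OF x] w[OF y] w[OF z] by (intro dvd_range_zero[of ?p]) auto
  \<comment> \<open>The modulus is odd, so 2 is invertible and equality of the doubled residues
    descends to the original ones.\<close>
  have inj: "c = e" if "?w c = ?w e" "(a, c) \<in> digit_pairs h" "(a, e) \<in> digit_pairs h" for c e
  proof -
    have "?p dvd 2 * (c - e)" using that(1) by (metis mod_eq_dvd_iff right_diff_distrib)
    moreover have "coprime ?p 2" by simp
    ultimately have "?p dvd c - e" using coprime_dvd_mult_right_iff by blast
    thus "c = e"
      using dvd_range_zero[of ?p "c - e"] digit_pairs_range[OF that(2) h] digit_pairs_range[OF that(3) h]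
      by auto
  qed
  have "?w bx + ?w bz = 2 * ?w b" using 0 by linarith
  hence "?w bx = ?w b \<and> ?w b = ?w bz \<or> 2 * (?w b)\<^sup>2 < (?w bx)\<^sup>2 + (?w bz)\<^sup>2"
    by (rule square_AP_strict)
  moreover have "fibre_coord h (a, c) = ?w c" for c using False by (simp add: fibre_coord_def)
  ultimately show ?thesis using inj[OF _ x y] inj[OF _ y z] by metis
qed

text \<open>With d = \<open>(h + 1) div 2\<close>, the shortened fibres give bx + bz <= 2d + ax + az
  - 2 = 2d + 2(a - h - 1) - 1, one less than the least residue of 2b allowed over a.\<close>

lemma no_downward_wrap:
  assumes h: "h \<ge> 1"
    and x: "(ax, bx) \<in> digit_pairs h" and y: "(a, b) \<in> digit_pairs h" and z: "(az, bz) \<in> digit_pairs h"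
    and a: "ax + az = 2 * a - (2 * h + 1)"
    and AP: "2 * h + 1 dvd bx - 2 * b + bz"
  shows False
proof -
  let ?p = "2 * h + 1" and ?d = "(h + 1) div 2"
  have nn: "0 \<le> ax" "0 \<le> az"
    using digit_pairs_range[OF x h] digit_pairs_range[OF z h] by auto
  have ah: "h < a" using nn a by linarith
  have "a \<le> h + ?d" using y by (auto simp: digit_pairs_def)
  \<comment> \<open>Since 2d <= h + 1, both outer terms lie over small first coordinates, where the
    fibres are initial intervals.\<close>
  hence "2 * a - ?p \<le> h" by linarith
  hence "ax \<le> h" "az \<le> h" using nn a by linarith+
  hence b: "0 \<le> bx" "0 \<le> bz" "bx \<le> h" "bz \<le> h" "bx < ?d + ax" "bz < ?d + az"
    using x z by (auto simp: digit_pairs_def digit_fibre_def Let_def)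
  have "(2 * b) mod ?p = (bx + bz) mod ?p"
  proof -
    have "?p dvd (bx + bz) - 2 * b" using AP by (simp add: algebra_simps)
    thus ?thesis by (metis mod_eq_dvd_iff)
  qed
  also have "\<dots> = bx + bz" using b by simp
  finally have "2 * ?d + 2 * (a - h - 1) \<le> bx + bz"
    using y ah by (simp add: digit_pairs_def digit_fibre_def Let_def)
  thus False using b a by presburger
qed

lemma weight_AP_strict:
  assumes h: "h \<ge> 1"
    and x: "x \<in> digit_pairs h" and y: "y \<in> digit_pairs h" and z: "z \<in> digit_pairs h"
    and AP: "2 * h + 1 dvd fst x - 2 * fst y + fst z" "2 * h + 1 dvd snd x - 2 * snd y + snd z"
  shows "x = y \<and> y = z \<or> 2 * weight h y < weight h x + weight h z"
proof -
  let ?p = "2 * h + 1"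
  obtain ax bx where vx: "x = (ax, bx)" by (cases x)
  obtain a b where vy: "y = (a, b)" by (cases y)
  obtain az bz where vz: "z = (az, bz)" by (cases z)
  note r = digit_pairs_range[OF x[unfolded vx] h] digit_pairs_range[OF y[unfolded vy] h]
    digit_pairs_range[OF z[unfolded vz] h]
  have "ax - 2 * a + az = - ?p \<or> ax - 2 * a + az = 0 \<or> ax - 2 * a + az = ?p"
    using AP(1) r unfolding vx vy vz fst_conv by (intro dvd_small_cases) auto
  moreover have "ax - 2 * a + az \<noteq> - ?p"
    using no_downward_wrap[OF h x[unfolded vx] y[unfolded vy] z[unfolded vz]] AP(2)
    by (auto simp: vx vy vz)
  ultimately consider "ax = a \<and> a = az" | "2 * a\<^sup>2 < ax\<^sup>2 + az\<^sup>2"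
  proof (elim disjE)
    assume "ax - 2 * a + az = 0"
    thus thesis using square_AP_strict[of ax az a] that by auto
  next
    \<comment> \<open>An upward wrap is harmless: it puts the mean of the outer terms above a, and
      the mean of squares is at least the square of the mean.\<close>
    assume "ax - 2 * a + az = ?p"
    hence "2 * a < ax + az" using h by linarith
    hence "(2 * a)\<^sup>2 < (ax + az)\<^sup>2" using r by (intro power_strict_mono) auto
    moreover have "(ax + az)\<^sup>2 + (ax - az)\<^sup>2 = 2 * (ax\<^sup>2 + az\<^sup>2)"
      by (simp add: power2_eq_square algebra_simps)
    moreover have "(ax - az)\<^sup>2 \<ge> 0" by simp
    ultimately have "(2 * a)\<^sup>2 < 2 * (ax\<^sup>2 + az\<^sup>2)" by linarith
    hence "2 * a\<^sup>2 < ax\<^sup>2 + az\<^sup>2" by (simp add: power_mult_distrib)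
    thus thesis using that by blast
  qed auto
  thus ?thesis
  proof cases
    case 1
    thus ?thesis
      using fibre_AP_strict[OF h, of a bx b bz] x y z AP(2)
      by (auto simp: vx vy vz weight_def)
  next
    case 2
    \<comment> \<open>By integrality the gap is at least 1; scaled by \<open>2 * ?p\<^sup>2\<close>
      it exceeds twice the middle tie-breaker.\<close>
    hence "2 * ?p\<^sup>2 * (2 * a\<^sup>2 + 1) \<le> 2 * ?p\<^sup>2 * (ax\<^sup>2 + az\<^sup>2)"
      by (intro mult_left_mono) auto
    moreover have "(fibre_coord h y)\<^sup>2 < ?p\<^sup>2"
      using square_less_of_range fibre_coord_bounds[OF y h] by auto
    moreover have "(fibre_coord h x)\<^sup>2 \<ge> 0" "(fibre_coord h z)\<^sup>2 \<ge> 0" by auto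
    ultimately have "2 * weight h y < weight h x + weight h z"
      unfolding weight_def vx vy vz fst_conv ring_distribs by linarith
    thus ?thesis ..
  qed
qed

section \<open>Counting the digit set\<close>

lemma card_digit_fibre_high:
  assumes h: "h \<ge> 1" and a: "a > h"
  shows "int (card (digit_fibre h a)) \<ge> 2 * h + 1 - 2 * ((h + 1) div 2) - 2 * (a - h - 1)"
proof -
  let ?p = "2 * h + 1" and ?t = "2 * ((h + 1) div 2) + 2 * (a - h - 1)"
  \<comment> \<open>h + 1 is the inverse of 2 modulo 2h + 1, so \<open>?g\<close> halves each
    admissible residue.\<close>
  let ?g = "\<lambda>w. ((h + 1) * w) mod (2 * h + 1)"
  have t: "0 \<le> ?t" using h a by (auto simp: pos_imp_zdiv_nonneg_iff)
  have g: "(2 * ?g w) mod ?p = w" if "w \<in> {?t..<?p}" for w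
  proof -
    have "(2 * ?g w) mod ?p = (2 * ((h + 1) * w)) mod ?p" by (rule mod_mult_right_eq)
    also have "2 * ((h + 1) * w) = w + ?p * w" by (simp add: algebra_simps)
    also have "(w + ?p * w) mod ?p = w mod ?p" by simp
    also have "\<dots> = w" using that t by simp
    finally show ?thesis .
  qed
  have "inj_on ?g {?t..<?p}" using g by (rule inj_on_inverseI)
  moreover have "?g ` {?t..<?p} \<subseteq> digit_fibre h a"
    using g a h by (auto simp: digit_fibre_def Let_def mod_odd_le)
  ultimately have "card {?t..<?p} \<le> card (digit_fibre h a)"
    using finite_digit_fibre by (rule card_inj_on_le)
  thus ?thesis by simp
qed

lemma sum_int_atLeastLessThan_shift:
  "(\<Sum>a\<in>{c..<c + int k}. f a) = (\<Sum>i<k. f (c + int i))"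
proof -
  have "{c..<c + int k} = (\<lambda>i. c + int i) ` {..<k}"
    by (auto simp: image_iff intro!: bexI[of _ "nat (_ - c)"])
  thus ?thesis by (simp add: sum.reindex inj_on_def)
qed

lemma card_digit_pairs:
  assumes h: "h \<ge> 1"
  shows "32 * int (card (digit_pairs h)) \<ge> 9 * (2 * h + 1)\<^sup>2"
proof -
  define d where "d = nat ((h + 1) div 2)"
  define e where "e = nat (h + 1) - d"
  let ?F = "\<lambda>a. int (card (digit_fibre h a))"
  have d: "int d = (h + 1) div 2" using h by (simp add: d_def)
  have de: "int d + int e = h + 1" using d h by (simp add: e_def)
  have low: "(\<Sum>i<d. ?F (0 + int i)) = (\<Sum>i<d. int d + int i)"
    using d by (intro sum.cong) (auto simp: digit_fibre_def Let_def)
  \<comment> \<open>The cap h + 1 may be missed by one: for even h the fibre over d has exactly 2d =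
    h points.\<close>
  have mid: "(\<Sum>i<e. ?F (int d + int i)) \<ge> (\<Sum>i<e. h)"
  proof (intro sum_mono)
    fix i assume "i \<in> {..<e}"
    hence "int d + int i \<le> h" using de by simp
    moreover have "h \<le> 2 * ((h + 1) div 2)" by presburger
    ultimately show "h \<le> ?F (int d + int i)"
      using d h by (simp add: digit_fibre_def Let_def min_def)
  qed
  have high: "(\<Sum>i<d. ?F (h + 1 + int i)) \<ge> (\<Sum>i<d. 2 * h + 1 - 2 * int d - 2 * int i)"
  proof (rule sum_mono)
    fix i
    show "2 * h + 1 - 2 * int d - 2 * int i \<le> ?F (h + 1 + int i)"
      using card_digit_fibre_high[OF h, of "h + 1 + int i"] d by simp
  qed
  have gauss: "2 * (\<Sum>i<k. int i) = int k * (int k - 1)" for k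
    by (induction k) (auto simp: algebra_simps)
  have "{0..<h + 1 + int d} = {0..<0 + int d} \<union> {int d..<int d + int e} \<union> {h + 1..<h + 1 + int d}"
    using de h by auto
  hence "int (card (digit_pairs h)) =
      (\<Sum>a\<in>{0..<0 + int d} \<union> {int d..<int d + int e} \<union> {h + 1..<h + 1 + int d}. ?F a)"
    using d finite_digit_fibre by (simp add: digit_pairs_def)
  also have "\<dots> = (\<Sum>a\<in>{0..<0 + int d}. ?F a) + (\<Sum>a\<in>{int d..<int d + int e}. ?F a)
      + (\<Sum>a\<in>{h + 1..<h + 1 + int d}. ?F a)"
    using de by (subst sum.union_disjoint; (subst sum.union_disjoint)?) auto
  also have "\<dots> \<ge> (\<Sum>i<d. int d + int i) + (\<Sum>i<e. h) + (\<Sum>i<d. 2 * h + 1 - 2 * int d - 2 * int i)"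
    unfolding sum_int_atLeastLessThan_shift low using mid high by linarith
  finally have card: "2 * int (card (digit_pairs h)) \<ge>
      2 * int d * int d + 2 * int e * h + 2 * int d * (2 * h + 1 - 2 * int d)
      - int d * (int d - 1)"
    using gauss[of d] unfolding sum.distrib sum_subtractf sum_distrib_left[symmetric]
    by (simp add: algebra_simps)
  \<comment> \<open>In both parities the two sides share the leading term 144 d^2; the terms of
    lower order decide.\<close>
  consider (even) "h = 2 * int d" "int e = int d + 1" | (odd) "h = 2 * int d - 1" "int e = int d"
    using d de by linarith
  thus ?thesis
  proof cases
    case even
    thus ?thesis using card h by (simp add: power2_eq_square algebra_simps)
  next
    case odd
    show ?thesis using card h unfolding odd by (simp add: power2_eq_square algebra_simps)
  qed
qed

section \<open>Level sets of the total weight\<close>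

lemma pigeonhole_card:
  fixes f :: "'a \<Rightarrow> nat"
  assumes "finite X" "\<And>x. x \<in> X \<Longrightarrow> f x \<le> N"
  shows "\<exists>r. card X \<le> (N + 1) * card {x \<in> X. f x = r}"
proof (rule ccontr)
  assume "\<not> ?thesis"
  hence less: "(N + 1) * card {x \<in> X. f x = r} < card X" for r by (simp add: not_le)
  have "card X = (\<Sum>r\<le>N. card {x \<in> X. f x = r})"
    using assms sum_fun_comp[of X "{..N}" f "\<lambda>_. 1 :: nat"] by auto
  hence "(N + 1) * card X = (\<Sum>r\<le>N. (N + 1) * card {x \<in> X. f x = r})"
    by (simp add: sum_distrib_left)
  also have "\<dots> < (\<Sum>r\<le>N. card X)" using less by (intro sum_strict_mono) auto
  finally show False by simp
qed

text \<open>Each digit fills two adjacent coordinates. For odd \<open>n\<close> the last coordinate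
  is frozen at 0, which costs only a factor independent of \<open>n\<close>.\<close>

definition interleave :: "nat \<Rightarrow> (nat \<Rightarrow> int \<times> int) \<Rightarrow> nat \<Rightarrow> int" where
  "interleave n u = (\<lambda>i\<in>{..<n}. if i div 2 < n div 2
     then (if even i then fst (u (i div 2)) else snd (u (i div 2))) else 0)"

lemma interleave_even: "i < n div 2 \<Longrightarrow> interleave n u (2 * i) = fst (u i)"
  and interleave_odd: "i < n div 2 \<Longrightarrow> interleave n u (2 * i + 1) = snd (u i)"
  by (auto simp: interleave_def)

lemma inj_on_interleave: "inj_on (interleave n) ({..<n div 2} \<rightarrow>\<^sub>E S)"
proof (rule inj_onI)
  fix u v assume uv: "u \<in> {..<n div 2} \<rightarrow>\<^sub>E S" "v \<in> {..<n div 2} \<rightarrow>\<^sub>E S"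
    and eq: "interleave n u = interleave n v"
  show "u = v"
  proof (rule PiE_ext[OF uv])
    fix i assume "i \<in> {..<n div 2}"
    thus "u i = v i"
      using interleave_even[of i n] interleave_odd[of i n] eq by (metis lessThan_iff prod_eq_iff)
  qed
qed

lemma carrier_residue_ring: "carrier (residue_ring m) = {0..m - 1}"
  by (simp add: residue_ring_def)

lemma interleave_in_Fp_space:
  assumes "u \<in> {..<n div 2} \<rightarrow>\<^sub>E S" "S \<subseteq> {0..<int p} \<times> {0..<int p}" "p > 0"
  shows "interleave n u \<in> Fp_space p n"
proof -
  have "fst (u i) \<in> {0..<int p} \<and> snd (u i) \<in> {0..<int p}" if "i < n div 2" for i
    using assms(1,2) that by (force simp: PiE_iff)
  thus ?thesis using assms(3) by (auto simp: Fp_space_def interleave_def carrier_residue_ring)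
qed

text \<open>On a level set the digitwise inequalities sum to an equality, so none is strict and the
  progression is constant. The factor before \<open>card A\<close> bounds the number of
  levels.\<close>

lemma exists_AP_free_large:
  assumes h: "h \<ge> 1" and p: "int p = 2 * h + 1"
  shows "\<exists>A \<subseteq> Fp_space p n. three_AP_free p n A \<and>
    card (digit_pairs h) ^ (n div 2) \<le> (3 * p ^ 4 * (n div 2) + 1) * card A"
proof -
  let ?m = "n div 2" and ?S = "digit_pairs h"
  let ?X = "{..<?m} \<rightarrow>\<^sub>E ?S"
  let ?f = "\<lambda>u. \<Sum>i<?m. nat (weight h (u i))"
  have S: "?S \<subseteq> {0..<int p} \<times> {0..<int p}" using digit_pairs_range[OF _ h] p by auto
  have mem: "u i \<in> ?S" if "u \<in> ?X" "i < ?m" for u i using that by auto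
  have "?f u \<le> 3 * p ^ 4 * ?m" if "u \<in> ?X" for u
  proof -
    have "nat (weight h (u i)) \<le> 3 * p ^ 4" if "i < ?m" for i
    proof -
      have "weight h (u i) < 3 * int p ^ 4"
        using weight_bounds[OF mem[OF \<open>u \<in> ?X\<close> that] h] p by simp
      also have "\<dots> = int (3 * p ^ 4)" by simp
      finally show ?thesis by linarith
    qed
    hence "?f u \<le> (\<Sum>i<?m. 3 * p ^ 4)" by (intro sum_mono) auto
    thus ?thesis by (simp add: mult.commute)
  qed
  moreover have "finite ?X" by (auto intro: finite_PiE finite_digit_pairs)
  ultimately obtain r where r: "card ?X \<le> (3 * p ^ 4 * ?m + 1) * card {u \<in> ?X. ?f u = r}"
    using pigeonhole_card[of ?X ?f] by blast
  define A where "A = interleave n ` {u \<in> ?X. ?f u = r}"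
  have "card A = card {u \<in> ?X. ?f u = r}"
    unfolding A_def by (intro card_image inj_on_subset[OF inj_on_interleave]) auto
  moreover have "card ?X = card ?S ^ ?m" by (simp add: card_PiE)
  moreover have "A \<subseteq> Fp_space p n"
    using interleave_in_Fp_space[OF _ S] p h by (auto simp: A_def)
  moreover have "three_AP_free p n A"
    unfolding three_AP_free_def
  proof (intro notI, elim bexE)
    fix x y z assume xyz: "x \<in> A" "y \<in> A" "z \<in> A" and AP: "three_term_AP p n x y z"
    obtain u where u: "x = interleave n u" "u \<in> ?X" "?f u = r" using xyz(1) by (auto simp: A_def)
    obtain v where v: "y = interleave n v" "v \<in> ?X" "?f v = r" using xyz(2) by (auto simp: A_def)
    obtain w where w: "z = interleave n w" "w \<in> ?X" "?f w = r" using xyz(3) by (auto simp: A_def)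
    have dvd: "int p dvd x i - 2 * y i + z i" if "i < n" for i
      using AP that by (auto simp: three_term_AP_def cong_0_iff)
    have strict: "u i = v i \<or> 2 * nat (weight h (v i)) < nat (weight h (u i)) + nat (weight h (w i))"
      and le: "2 * nat (weight h (v i)) \<le> nat (weight h (u i)) + nat (weight h (w i))"
      if i: "i < ?m" for i
    proof -
      have "2 * i < n" "2 * i + 1 < n" using i by auto
      hence "2 * h + 1 dvd fst (u i) - 2 * fst (v i) + fst (w i)"
        "2 * h + 1 dvd snd (u i) - 2 * snd (v i) + snd (w i)"
        using dvd[of "2 * i"] dvd[of "2 * i + 1"] p i
        by (simp_all only: u v w interleave_even interleave_odd)
      hence "u i = v i \<and> v i = w i \<or> 2 * weight h (v i) < weight h (u i) + weight h (w i)"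
        using weight_AP_strict[OF h] mem i u v w by blast
      moreover have "weight h (u i) \<ge> 0" "weight h (v i) \<ge> 0" "weight h (w i) \<ge> 0"
        using weight_bounds(1)[OF _ h] mem i u v w by blast+
      ultimately show "u i = v i \<or> 2 * nat (weight h (v i)) < nat (weight h (u i)) + nat (weight h (w i))"
        "2 * nat (weight h (v i)) \<le> nat (weight h (u i)) + nat (weight h (w i))"
        by auto
    qed
    have "u = v"
    proof (rule ccontr)
      assume "u \<noteq> v"
      then obtain j where j: "j < ?m" "u j \<noteq> v j" using PiE_ext[OF u(2) v(2)] by blast
      have "(\<Sum>i<?m. 2 * nat (weight h (v i))) < (\<Sum>i<?m. nat (weight h (u i)) + nat (weight h (w i)))"
        using le strict[of j] j by (intro sum_strict_mono_ex1) auto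
      thus False using u(3) v(3) w(3) by (simp add: sum.distrib sum_distrib_left[symmetric])
    qed
    thus False using AP u v by (simp add: three_term_AP_def)
  qed
  ultimately show ?thesis using r by auto
qed

text \<open>Modulo 2 the equation becomes x + z = 0, that is x = z.\<close>

lemma three_AP_free_char_2: "three_AP_free 2 n (Fp_space 2 n)"
  unfolding three_AP_free_def
proof (intro notI, elim bexE)
  fix x y z assume AP: "three_term_AP 2 n x y z"
  have "x = z"
  proof (rule PiE_ext)
    show "x \<in> {..<n} \<rightarrow>\<^sub>E {0..1}" "z \<in> {..<n} \<rightarrow>\<^sub>E {0..1}"
      using AP by (auto simp: three_term_AP_def Fp_space_def carrier_residue_ring)
    fix i assume i: "i \<in> {..<n}"
    hence "x i \<in> {0..1}" "z i \<in> {0..1}"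
      using AP by (auto simp: three_term_AP_def Fp_space_def carrier_residue_ring)
    moreover have "even (x i - 2 * y i + z i)"
      using AP i by (auto simp: three_term_AP_def cong_0_iff)
    ultimately show "x i = z i" unfolding atLeastAtMost_iff by presburger
  qed
  thus False using AP by (simp add: three_term_AP_def)
qed

section \<open>The choice of the constant and the final estimate\<close>

lemma card_Fp_space: "card (Fp_space p n) = p ^ n"
  by (simp add: Fp_space_def carrier_residue_ring card_PiE)

theorem theorem1p1:
  shows "\<exists>c::real. c > 1 / 2 \<and>
    (\<forall>p::nat. prime p \<longrightarrow>
      (\<exists>n0::nat. \<forall>n::nat. n \<ge> n0 \<longrightarrow>
        (\<exists>A. A \<subseteq> Fp_space p n \<and>
             real (card A) \<ge> (c * real p) ^ n \<and>
             three_AP_free p n A)))"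
proof (intro exI[of _ "13 / 25"] conjI allI impI)
  show "(13 / 25 :: real) > 1 / 2" by simp
next
  fix p :: nat assume prime: "prime p"
  \<comment> \<open>A digit set of 9/32 p^2 points yields sqrt(9/32) p, about 0.53 p, per
    coordinate; 13/25 lies between 1/2 and this rate.\<close>
  let ?c = "13 / 25 :: real"
  show "\<exists>n0. \<forall>n\<ge>n0. \<exists>A\<subseteq>Fp_space p n. real (card A) \<ge> (?c * real p) ^ n \<and> three_AP_free p n A"
  proof (cases "p = 2")
    case True
    have "(?c * real p) ^ n \<le> real (card (Fp_space p n))" for n
      unfolding card_Fp_space of_nat_power by (intro power_mono) auto
    thus ?thesis using True three_AP_free_char_2 by blast
  next
    case False
    hence "p \<ge> 3" "odd p" using prime prime_ge_2_nat[of p] prime_odd_nat[of p] by force+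
    define h where "h = (int p - 1) div 2"
    have p: "int p = 2 * h + 1" using \<open>odd p\<close> by (simp add: h_def)
    have h: "h \<ge> 1" using p \<open>p \<ge> 3\<close> by linarith
    define C where "C = 3 * real p ^ 4"
    have "C > 0" using \<open>p \<ge> 3\<close> by (simp add: C_def)
    define D where "D = ?c * real p"
    have "D > 0" using \<open>p \<ge> 3\<close> by (simp add: D_def)
    with \<open>C > 0\<close> have "eventually (\<lambda>m. (C * real m + 1) * D \<le> (5625 / 5408) ^ m) sequentially"
      by real_asymp
    \<comment> \<open>The base 5625/5408 is (9/32) / (13/25)^2 > 1, the gain per digit; it
      eventually beats the pigeonhole loss and the factor \<open>D\<close> for an unpaired
      coordinate.\<close>
    then obtain m0 where m0: "\<And>m. m \<ge> m0 \<Longrightarrow> (C * real m + 1) * D \<le> (5625 / 5408) ^ m"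
      by (auto simp: eventually_sequentially)
    have "\<exists>A\<subseteq>Fp_space p n. real (card A) \<ge> (?c * real p) ^ n \<and> three_AP_free p n A"
      if n: "n \<ge> 2 * m0" for n
    proof -
      let ?m = "n div 2"
      obtain A where A: "A \<subseteq> Fp_space p n" "three_AP_free p n A"
        "card (digit_pairs h) ^ ?m \<le> (3 * p ^ 4 * ?m + 1) * card A"
        using exists_AP_free_large[OF h p] by blast
      have "real_of_int (9 * (2 * h + 1)\<^sup>2) \<le> real_of_int (32 * int (card (digit_pairs h)))"
        using card_digit_pairs[OF h] by (simp only: of_int_le_iff)
      hence S: "9 / 32 * (real p)\<^sup>2 \<le> real (card (digit_pairs h))"
        unfolding p[symmetric] by simp
      have pos: "C * real ?m + 1 > 0" using \<open>C > 0\<close> by (simp add: add_nonneg_pos)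
      \<comment> \<open>Raising the exponent is allowed because p >= 3 makes the base at least
        1.\<close>
      have "(?c * real p) ^ n \<le> D ^ (2 * ?m + 1)"
        unfolding D_def using \<open>p \<ge> 3\<close> by (intro power_increasing) auto
      also have "\<dots> = D * (D\<^sup>2) ^ ?m" by (simp add: power_mult)
      finally have "(C * real ?m + 1) * (?c * real p) ^ n \<le> (C * real ?m + 1) * (D * (D\<^sup>2) ^ ?m)"
        using pos by (intro mult_left_mono) auto
      also have "\<dots> = ((C * real ?m + 1) * D) * (D\<^sup>2) ^ ?m" by simp
      also have "\<dots> \<le> (5625 / 5408) ^ ?m * (D\<^sup>2) ^ ?m"
        using n by (intro mult_right_mono m0) auto
      also have "\<dots> = (5625 / 5408 * D\<^sup>2) ^ ?m" by (rule power_mult_distrib[symmetric])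
      also have "\<dots> = (9 / 32 * (real p)\<^sup>2) ^ ?m"
        by (simp add: D_def power2_eq_square)
      also have "\<dots> \<le> real (card (digit_pairs h)) ^ ?m" using S by (intro power_mono) auto
      also have "\<dots> \<le> real ((3 * p ^ 4 * ?m + 1) * card A)"
        using A(3) by (simp only: of_nat_le_iff flip: of_nat_power)
      also have "\<dots> = (C * real ?m + 1) * real (card A)" by (simp add: C_def distrib_right)
      finally have "(?c * real p) ^ n \<le> real (card A)" using pos by simp
      thus ?thesis using A by blast
    qed
    thus ?thesis by blast
  qed
qed

end
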